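(* Let $G$ and $H$ be any two graphs (with nonempty vertex sets), with $|V(G)|=m$, and let $G\circ H$ denote the corona of $G$ and $H$. Then $$\gamma_{ds}(G\circ H)=\begin{cases} m\cdot\min\{\gamma_{ds}(H),\,1+\gamma(H)\}, & \text{if } H\not\cong K_1,\\ m+\gamma(G), & \text{if } H\cong K_1.\end{cases}$$
   Context: All graphs are finite, simple and undirected. $K_1$ is the graph with one vertex. A set $S\subseteq V(G)$ is a dominating set of $G$ if every vertex of $V(G)\setminus S$ has a neighbour in $S$; the domination number $\gamma(G)$ is the minimum cardinality of a dominating set of $G$. A set $S\subseteq V(G)$ is a dual-server dominating set (DS-dominating set) of $G$ if there is a partition $\{R,B\}$ of $S$ such that every vertex of $V(G)\setminus S$ has at least one neighbour in $R$ and at least one neighbour in $B$. The dual-server domination number $\gamma_{ds}(G)$ is the minimum cardinality of a DS-dominating set of $G$. The corona $G\circ H$ is the graph formed from one copy of $G$ and $|V(G)|$ disjoint copies of $H$ by making, for each $i$, the $i$-th vertex of $G$ adjacent to every vertex of the $i$-th copy of $H$. *)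

theory Defs
  imports Graph_Theory.Graph_Theory
begin

text \<open>A finite simple undirected graph is represented as a \<^locale>\<open>pair_graph\<close>: each edge
  \<open>uv\<close> is the pair of arcs \<open>(u, v)\<close> and \<open>(v, u)\<close>, so \<open>v\<close> is a neighbour of \<open>u\<close> iff
  \<open>(u, v) \<in> parcs G\<close>.\<close>

definition dominating_set :: "'a pair_pre_digraph \<Rightarrow> 'a set \<Rightarrow> bool" where
  "dominating_set G S \<longleftrightarrow>
     S \<subseteq> pverts G \<and> (\<forall>v \<in> pverts G - S. \<exists>u \<in> S. (v, u) \<in> parcs G)"

definition domination_number :: "'a pair_pre_digraph \<Rightarrow> nat" where
  "domination_number G = (LEAST k. \<exists>S. dominating_set G S \<and> card S = k)"

text \<open>The parts \<open>R\<close> and \<open>B\<close> may be empty, so that the whole vertex set is always a DS-dominating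
  set and the number below is defined for every graph. This matters only for graphs with fewer
  than two vertices, see \<open>ds_dominating_set_nonempty_parts\<close>.\<close>

definition ds_dominating_set :: "'a pair_pre_digraph \<Rightarrow> 'a set \<Rightarrow> bool" where
  "ds_dominating_set G S \<longleftrightarrow>
     S \<subseteq> pverts G \<and>
     (\<exists>R B. R \<union> B = S \<and> R \<inter> B = {} \<and>
        (\<forall>v \<in> pverts G - S. (\<exists>r \<in> R. (v, r) \<in> parcs G) \<and> (\<exists>b \<in> B. (v, b) \<in> parcs G)))"

definition ds_domination_number :: "'a pair_pre_digraph \<Rightarrow> nat" where
  "ds_domination_number G = (LEAST k. \<exists>S. ds_dominating_set G S \<and> card S = k)"

text \<open>\<open>Inl u\<close> is the vertex \<open>u\<close> of \<open>G\<close>, and \<open>Inr (u, x)\<close> is the vertex \<open>x\<close> in the copy of \<open>H\<close>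
  belonging to \<open>u\<close>.\<close>

definition corona ::
  "'a pair_pre_digraph \<Rightarrow> 'b pair_pre_digraph \<Rightarrow> ('a + 'a \<times> 'b) pair_pre_digraph" where
  "corona G H =
     \<lparr> pverts = Inl ` pverts G \<union> Inr ` (pverts G \<times> pverts H),
       parcs = {(Inl u, Inl v) | u v. (u, v) \<in> parcs G}
         \<union> {(Inr (u, x), Inr (u, y)) | u x y. u \<in> pverts G \<and> (x, y) \<in> parcs H}
         \<union> {(Inl u, Inr (u, x)) | u x. u \<in> pverts G \<and> x \<in> pverts H}
         \<union> {(Inr (u, x), Inl u) | u x. u \<in> pverts G \<and> x \<in> pverts H} \<rparr>"

definition K1 :: "unit pair_pre_digraph" where
  "K1 = \<lparr> pverts = {()}, parcs = {} \<rparr>"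

lemma ds_dominating_set_verts: "ds_dominating_set G (pverts G)"
  unfolding ds_dominating_set_def by auto

lemma ds_dominating_set_nonempty_parts:
  assumes "2 \<le> card (pverts G)"
  shows "ds_dominating_set G S \<longleftrightarrow>
     S \<subseteq> pverts G \<and>
     (\<exists>R B. R \<noteq> {} \<and> B \<noteq> {} \<and> R \<union> B = S \<and> R \<inter> B = {} \<and>
        (\<forall>v \<in> pverts G - S. (\<exists>r \<in> R. (v, r) \<in> parcs G) \<and> (\<exists>b \<in> B. (v, b) \<in> parcs G)))"
proof (cases "S = pverts G")
  case True
  from assms obtain a b where ab: "a \<in> pverts G" "b \<in> pverts G" "a \<noteq> b"
    by (metis Suc_n_not_le_n card.infinite card_le_Suc0_iff_eq le_trans numeral_2_eq_2 zero_le)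
  have "{a} \<noteq> {} \<and> S - {a} \<noteq> {} \<and> {a} \<union> (S - {a}) = S \<and> {a} \<inter> (S - {a}) = {}"
    using ab True by auto
  then have "\<exists>R B. R \<noteq> {} \<and> B \<noteq> {} \<and> R \<union> B = S \<and> R \<inter> B = {}"
    by (intro exI[of _ "{a}"] exI[of _ "S - {a}"])
  then show ?thesis
    using True ds_dominating_set_verts[of G] by simp
next
  case False
  show ?thesis
  proof (cases "S \<subseteq> pverts G")
    case True
    with False obtain v where "v \<in> pverts G - S"
      by blast
    then show ?thesis
      unfolding ds_dominating_set_def by blast
  next
    case False
    then show ?thesis
      by (simp add: ds_dominating_set_def)
  qed
qed

lemma pair_graph_corona:
  assumes "pair_graph G" "pair_graph H"
  shows "pair_graph (corona G H)"
proof -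
  interpret G: pair_graph G by fact
  interpret H: pair_graph H by fact
  have sub: "parcs (corona G H) \<subseteq> pverts (corona G H) \<times> pverts (corona G H)"
    by (auto simp: corona_def dest: G.wellformed' H.wellformed')
  have fin: "finite (pverts (corona G H))"
    by (simp add: corona_def G.pair_finite_verts H.pair_finite_verts)
  show ?thesis
  proof
    show "finite (parcs (corona G H))"
      using sub fin by (meson finite_SigmaI finite_subset)
    show "symmetric (with_proj (corona G H))"
      by (auto simp: symmetric_def sym_def corona_def intro: G.arcs_symmetric H.arcs_symmetric)
    show "fst e \<noteq> snd e" if "e \<in> parcs (corona G H)" for e
      using that by (auto simp: corona_def dest: G.no_loops' H.no_loops')
    show "fst e \<in> pverts (corona G H)" "snd e \<in> pverts (corona G H)"
      if "e \<in> parcs (corona G H)" for e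
      using subsetD[OF sub that] by (simp_all add: mem_Times_iff)
    show "finite (pverts (corona G H))"
      by (rule fin)
  qed
qed

lemma digraph_iso_K1_iff:
  assumes "pair_graph H"
  shows "digraph_iso (with_proj H) (with_proj K1) \<longleftrightarrow> card (pverts H) = 1"
proof
  assume "digraph_iso (with_proj H) (with_proj K1)"
  then obtain f where f: "pre_digraph.digraph_isomorphism (with_proj H) f"
    and "with_proj K1 = app_iso f (with_proj H)"
    unfolding digraph_iso_def by blast
  then have "verts (with_proj K1) = verts (app_iso f (with_proj H))"
    by simp
  then have "iso_verts f ` pverts H = {()}"
    by (simp add: K1_def)
  moreover have "inj_on (iso_verts f) (pverts H)"
    using f by (simp add: pre_digraph.digraph_isomorphism_def)
  ultimately show "card (pverts H) = 1"
    by (metis card_image is_singletonI is_singleton_altdef)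
next
  assume "card (pverts H) = 1"
  then obtain x where x: "pverts H = {x}"
    by (metis card_1_singletonE)
  interpret H: pair_graph H by fact
  have e: "parcs H = {}"
  proof -
    have "p = (x, x)" if "p \<in> parcs H" for p
      using H.arc_fst_in_verts[OF that] H.arc_snd_in_verts[OF that] x by (simp add: prod_eq_iff)
    then show ?thesis
      using H.no_loops' by fast
  qed
  let ?f = "\<lparr> iso_verts = \<lambda>_. (), iso_arcs = \<lambda>_. ((), ()), iso_head = snd, iso_tail = fst \<rparr>"
  have "pre_digraph.digraph_isomorphism (with_proj H) ?f"
    using x e H.wf_digraph by (simp add: pre_digraph.digraph_isomorphism_def)
  moreover have "with_proj K1 = app_iso ?f (with_proj H)"
    using x e by (simp add: K1_def with_proj_def app_iso_def)
  ultimately show "digraph_iso (with_proj H) (with_proj K1)"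
    unfolding digraph_iso_def by blast
qed

end

theory Submission
  imports Defs
begin

text \<open>The vertices of the corona \<open>G \<circ> H\<close> fall into one block per vertex \<open>u\<close> of \<open>G\<close>, consisting of
  \<open>u\<close> and its copy of \<open>H\<close>. A copy vertex has all its neighbours in its own block, so a
  DS-dominating set \<open>S\<close> can be analysed block by block. Let \<open>T\<close> be the trace of \<open>S\<close> on the copy
  of \<open>H\<close> at \<open>u\<close>. If \<open>u \<notin> S\<close>, the copy has to be served from within, so \<open>T\<close> is DS-dominating in
  \<open>H\<close>. If \<open>u \<in> S\<close>, then \<open>u\<close> serves one colour only, and the other colour makes \<open>T\<close> dominating in
  \<open>H\<close> (\<open>corona_trace_bound\<close>). Every block therefore contains at least
  \<open>min {\<gamma>\<^sub>d\<^sub>s(H), 1 + \<gamma>(H)}\<close> vertices of \<open>S\<close>.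

  When \<open>H\<close> has at least two vertices, each term of the minimum can be realised in every block: put a minimum
  DS-dominating set in each copy, or put all of \<open>V(G)\<close> in one colour and a minimum dominating set
  of each copy in the other. The first construction needs both colours to be present in each copy,
  because \<open>u\<close> itself has to be served; two vertices in \<open>H\<close> are enough to arrange this
  (\<open>ds_dominating_set_nonempty_parts\<close>), while for \<open>H \<cong> K\<^sub>1\<close> it is impossible. In that case the copies
  are pendant vertices, which have a single neighbour and so all belong to \<open>S\<close>; the pendant vertex
  at \<open>u\<close> serves \<open>u\<close> with one colour, and the other colour has to come from \<open>G\<close>. So \<open>S \<inter> V(G)\<close>
  dominates \<open>G\<close>, and conversely a dominating set of \<open>G\<close> in one colour and all pendant vertices in
  the other form a DS-dominating set.\<close>

lemma domination_number_le: "dominating_set G S \<Longrightarrow> domination_number G \<le> card S"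
  unfolding domination_number_def by (blast intro: Least_le)

lemma obtain_minimum_dominating_set:
  obtains S where "dominating_set G S" "card S = domination_number G"
proof -
  have "dominating_set G (pverts G)"
    by (simp add: dominating_set_def)
  then have "\<exists>k S. dominating_set G S \<and> card S = k"
    by blast
  from LeastI_ex[OF this] show ?thesis
    unfolding domination_number_def[symmetric] using that by blast
qed

lemma ds_domination_number_le: "ds_dominating_set G S \<Longrightarrow> ds_domination_number G \<le> card S"
  unfolding ds_domination_number_def by (blast intro: Least_le)

lemma obtain_minimum_ds_dominating_set:
  obtains S where "ds_dominating_set G S" "card S = ds_domination_number G"
proof -
  have "\<exists>k S. ds_dominating_set G S \<and> card S = k"
    using ds_dominating_set_verts by blast
  from LeastI_ex[OF this] show ?thesis
    unfolding ds_domination_number_def[symmetric] using that by blast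
qed

lemma ds_dominating_setI:
  assumes "S \<subseteq> pverts G" "R \<union> B = S" "R \<inter> B = {}"
    and "\<And>v. v \<in> pverts G - S \<Longrightarrow> \<exists>r\<in>R. (v, r) \<in> parcs G"
    and "\<And>v. v \<in> pverts G - S \<Longrightarrow> \<exists>b\<in>B. (v, b) \<in> parcs G"
  shows "ds_dominating_set G S"
  unfolding ds_dominating_set_def
  by (rule conjI[OF assms(1)], rule exI[where x = R], rule exI[where x = B]) (simp add: assms)

lemma pverts_corona: "pverts (corona G H) = pverts G <+> pverts G \<times> pverts H"
  by (auto simp: corona_def)

lemma parcs_corona_simps:
  "(Inl u, Inl v) \<in> parcs (corona G H) \<longleftrightarrow> (u, v) \<in> parcs G"
  "(Inl u, Inr (v, x)) \<in> parcs (corona G H) \<longleftrightarrow> u = v \<and> u \<in> pverts G \<and> x \<in> pverts H"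
  "(Inr (v, x), Inl u) \<in> parcs (corona G H) \<longleftrightarrow> u = v \<and> u \<in> pverts G \<and> x \<in> pverts H"
  "(Inr (u, x), Inr (v, y)) \<in> parcs (corona G H) \<longleftrightarrow> u = v \<and> u \<in> pverts G \<and> (x, y) \<in> parcs H"
  by (auto simp: corona_def)

lemma corona_subset_decompose:
  assumes "S \<subseteq> pverts (corona G H)"
  shows "S = {u. Inl u \<in> S} <+> (SIGMA u : pverts G. {x. Inr (u, x) \<in> S})"
  using assms by (auto simp: pverts_corona)

lemma card_Plus_Sigma:
  assumes "finite C" "finite A" "\<And>u. u \<in> A \<Longrightarrow> finite (T u)"
  shows "card (C <+> (SIGMA u : A. T u)) = card C + (\<Sum>u\<in>A. card (T u))"
  using assms by (simp add: card_Plus)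

lemma corona_trace_bound:
  assumes ds: "ds_dominating_set (corona G H) S" and u: "u \<in> pverts G"
  shows "min (ds_domination_number H) (1 + domination_number H)
    \<le> of_bool (Inl u \<in> S) + card {x. Inr (u, x) \<in> S}"
proof -
  let ?T = "{x. Inr (u, x) \<in> S}"
  obtain R B where RB: "R \<union> B = S" "R \<inter> B = {}" and S: "S \<subseteq> pverts (corona G H)"
    and served: "\<And>v. v \<in> pverts (corona G H) - S \<Longrightarrow>
      (\<exists>r\<in>R. (v, r) \<in> parcs (corona G H)) \<and> (\<exists>b\<in>B. (v, b) \<in> parcs (corona G H))"
    using ds unfolding ds_dominating_set_def by blast
  have T: "?T \<subseteq> pverts H"
    using S by (auto simp: pverts_corona)
  have nbr: "Inl u \<in> Q \<or> (\<exists>y. Inr (u, y) \<in> Q \<and> (x, y) \<in> parcs H)"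
    if "x \<in> pverts H - ?T" "Q = R \<or> Q = B" for x Q
  proof -
    have "Inr (u, x) \<in> pverts (corona G H) - S"
      using that u by (auto simp: pverts_corona)
    then obtain q where q: "q \<in> Q" "(Inr (u, x), q) \<in> parcs (corona G H)"
      using served[of "Inr (u, x)"] \<open>Q = R \<or> Q = B\<close> by blast
    show ?thesis
    proof (cases q)
      case (Inl v)
      then show ?thesis using q by (simp add: parcs_corona_simps)
    next
      case (Inr p)
      then show ?thesis using q by (cases p) (auto simp: parcs_corona_simps)
    qed
  qed
  show ?thesis
  proof (cases "Inl u \<in> S")
    case False
    then have "Inl u \<notin> R" "Inl u \<notin> B"
      using RB by auto
    then have "ds_dominating_set H ?T"
      using T RB nbr[of _ R] nbr[of _ B]
      by (intro ds_dominating_setI[where R = "{x. Inr (u, x) \<in> R}" and B = "{x. Inr (u, x) \<in> B}"])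
        blast+
    from ds_domination_number_le[OF this] show ?thesis
      using False by simp
  next
    case True
    \<comment> \<open>\<open>Q\<close> is the colour that \<open>u\<close> does not have.\<close>
    then obtain Q where Q: "Q = R \<or> Q = B" "Inl u \<notin> Q"
      using RB by blast
    then have "dominating_set H ?T"
      unfolding dominating_set_def using T RB nbr[of _ Q] by blast
    from domination_number_le[OF this] show ?thesis
      using True by simp
  qed
qed

lemma ds_domination_number_corona_ge:
  assumes G: "pair_graph G" and H: "pair_graph H"
  shows "card (pverts G) * min (ds_domination_number H) (1 + domination_number H)
    \<le> ds_domination_number (corona G H)"
proof -
  interpret G: pair_graph G by fact
  interpret H: pair_graph H by fact
  obtain S where S: "ds_dominating_set (corona G H) S"
    "card S = ds_domination_number (corona G H)"
    by (rule obtain_minimum_ds_dominating_set)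
  let ?C = "{u. Inl u \<in> S}" and ?T = "\<lambda>u. {x. Inr (u, x) \<in> S}"
  have sub: "S \<subseteq> pverts (corona G H)"
    using S by (simp add: ds_dominating_set_def)
  have C: "?C \<subseteq> pverts G" and T: "?T u \<subseteq> pverts H" for u
    using sub by (auto simp: pverts_corona)
  have "card (pverts G) * min (ds_domination_number H) (1 + domination_number H)
    \<le> (\<Sum>u\<in>pverts G. of_bool (Inl u \<in> S) + card (?T u))"
    by (rule sum_bounded_below[where 'a = nat, unfolded of_nat_id])
      (rule corona_trace_bound[OF S(1)])
  also have "\<dots> = card ?C + (\<Sum>u\<in>pverts G. card (?T u))"
    using C by (simp add: sum.distrib sum_of_bool_eq G.pair_finite_verts Int_absorb1)
  also have "\<dots> = card (?C <+> (SIGMA u : pverts G. ?T u))"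
    by (rule card_Plus_Sigma[symmetric, OF finite_subset[OF C] _ finite_subset[OF T]])
      (rule G.pair_finite_verts H.pair_finite_verts)+
  also have "\<dots> = card S"
    using corona_subset_decompose[OF sub] by simp
  finally show ?thesis
    using S(2) by simp
qed

lemma ds_domination_number_corona_le_ds:
  assumes card_H: "2 \<le> card (pverts H)"
  shows "ds_domination_number (corona G H) \<le> card (pverts G) * ds_domination_number H"
proof -
  obtain D where D: "ds_dominating_set H D" "card D = ds_domination_number H"
    by (rule obtain_minimum_ds_dominating_set)
  then obtain R B where ne: "R \<noteq> {}" "B \<noteq> {}" and RB: "R \<union> B = D" "R \<inter> B = {}"
    and sub: "D \<subseteq> pverts H"
    and served: "\<forall>v \<in> pverts H - D. (\<exists>r\<in>R. (v, r) \<in> parcs H) \<and> (\<exists>b\<in>B. (v, b) \<in> parcs H)"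
    using ds_dominating_set_nonempty_parts[OF card_H] by metis
  let ?S = "\<lambda>Q. Inr ` (pverts G \<times> Q)"
  have nbr: "\<exists>q\<in>?S Q. (v, q) \<in> parcs (corona G H)"
    if v: "v \<in> pverts (corona G H) - ?S D" and Q: "Q \<noteq> {}" "Q \<subseteq> pverts H"
      "\<forall>v \<in> pverts H - D. \<exists>q\<in>Q. (v, q) \<in> parcs H" for v Q
  proof -
    consider u where "v = Inl u" "u \<in> pverts G"
      | u x where "v = Inr (u, x)" "u \<in> pverts G" "x \<in> pverts H - D"
      using v by (auto simp: pverts_corona)
    then show ?thesis
    proof cases
      case 1
      then show ?thesis using Q(1,2) by (auto simp: parcs_corona_simps)
    next
      case 2
      then show ?thesis using Q(3) by (fastforce simp: parcs_corona_simps)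
    qed
  qed
  have "ds_dominating_set (corona G H) (?S D)"
  proof (rule ds_dominating_setI[where R = "?S R" and B = "?S B"])
    show "?S D \<subseteq> pverts (corona G H)"
      using sub by (auto simp: pverts_corona)
    show "?S R \<union> ?S B = ?S D" "?S R \<inter> ?S B = {}"
      using RB by auto
    show "\<exists>r\<in>?S R. (v, r) \<in> parcs (corona G H)" "\<exists>b\<in>?S B. (v, b) \<in> parcs (corona G H)"
      if "v \<in> pverts (corona G H) - ?S D" for v
      using nbr[OF that, of R] nbr[OF that, of B] ne RB sub served by blast+
  qed
  from ds_domination_number_le[OF this] show ?thesis
    using D(2) by (simp add: card_image card_cartesian_product)
qed

lemma ds_domination_number_corona_le_dom:
  assumes G: "pair_graph G" and H: "pair_graph H"
  shows "ds_domination_number (corona G H) \<le> card (pverts G) * (1 + domination_number H)"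
proof -
  interpret G: pair_graph G by fact
  interpret H: pair_graph H by fact
  obtain D where D: "dominating_set H D" "card D = domination_number H"
    by (rule obtain_minimum_dominating_set)
  then have sub: "D \<subseteq> pverts H"
    by (simp add: dominating_set_def)
  have "ds_dominating_set (corona G H) (pverts G <+> pverts G \<times> D)"
  proof (rule ds_dominating_setI[where R = "Inl ` pverts G" and B = "Inr ` (pverts G \<times> D)"])
    show "pverts G <+> pverts G \<times> D \<subseteq> pverts (corona G H)"
      using sub by (auto simp: pverts_corona)
    show "Inl ` pverts G \<union> Inr ` (pverts G \<times> D) = pverts G <+> pverts G \<times> D"
      "Inl ` pverts G \<inter> Inr ` (pverts G \<times> D) = {}"
      by auto
    fix v assume "v \<in> pverts (corona G H) - (pverts G <+> pverts G \<times> D)"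
    then obtain u x where v: "v = Inr (u, x)" "u \<in> pverts G" "x \<in> pverts H - D"
      by (auto simp: pverts_corona)
    show "\<exists>r\<in>Inl ` pverts G. (v, r) \<in> parcs (corona G H)"
      using v by (auto simp: parcs_corona_simps)
    show "\<exists>b\<in>Inr ` (pverts G \<times> D). (v, b) \<in> parcs (corona G H)"
      using v D(1) by (fastforce simp: parcs_corona_simps dominating_set_def)
  qed
  from ds_domination_number_le[OF this] show ?thesis
    using D(2) finite_subset[OF sub H.pair_finite_verts] G.pair_finite_verts
    by (simp add: card_Plus card_cartesian_product)
qed

lemma ds_domination_number_corona_singleton:
  assumes G: "pair_graph G" and H: "pair_graph H" and x: "pverts H = {x}"
  shows "ds_domination_number (corona G H) = card (pverts G) + domination_number G"
proof (rule antisym)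
  interpret G: pair_graph G by fact
  interpret H: pair_graph H by fact
  have no_arcs: "(a, b) \<notin> parcs H" for a b
    using H.no_loops' H.wellformed' x by (metis singletonD)
  show "ds_domination_number (corona G H) \<le> card (pverts G) + domination_number G"
  proof -
    obtain D where D: "dominating_set G D" "card D = domination_number G"
      by (rule obtain_minimum_dominating_set)
    then have sub: "D \<subseteq> pverts G"
      by (simp add: dominating_set_def)
    have "ds_dominating_set (corona G H) (D <+> pverts G \<times> {x})"
    proof (rule ds_dominating_setI[where R = "Inl ` D" and B = "Inr ` (pverts G \<times> {x})"])
      show "D <+> pverts G \<times> {x} \<subseteq> pverts (corona G H)"
        using sub x by (auto simp: pverts_corona)
      show "Inl ` D \<union> Inr ` (pverts G \<times> {x}) = D <+> pverts G \<times> {x}"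
        "Inl ` D \<inter> Inr ` (pverts G \<times> {x}) = {}"
        by auto
      fix v assume "v \<in> pverts (corona G H) - (D <+> pverts G \<times> {x})"
      then obtain u where v: "v = Inl u" "u \<in> pverts G - D"
        using x by (auto simp: pverts_corona)
      show "\<exists>r\<in>Inl ` D. (v, r) \<in> parcs (corona G H)"
        using v D(1) by (fastforce simp: parcs_corona_simps dominating_set_def)
      show "\<exists>b\<in>Inr ` (pverts G \<times> {x}). (v, b) \<in> parcs (corona G H)"
        using v x by (auto simp: parcs_corona_simps)
    qed
    from ds_domination_number_le[OF this] show ?thesis
      using D(2) finite_subset[OF sub G.pair_finite_verts] G.pair_finite_verts
      by (simp add: card_Plus card_cartesian_product)
  qed
  show "card (pverts G) + domination_number G \<le> ds_domination_number (corona G H)"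
  proof -
    obtain S where S: "ds_dominating_set (corona G H) S"
      "card S = ds_domination_number (corona G H)"
      by (rule obtain_minimum_ds_dominating_set)
    then obtain R B where RB: "R \<union> B = S" "R \<inter> B = {}" and sub: "S \<subseteq> pverts (corona G H)"
      and served: "\<And>v. v \<in> pverts (corona G H) - S \<Longrightarrow>
        (\<exists>r\<in>R. (v, r) \<in> parcs (corona G H)) \<and> (\<exists>b\<in>B. (v, b) \<in> parcs (corona G H))"
      unfolding ds_dominating_set_def by blast
    let ?C = "{u. Inl u \<in> S}"
    have C: "?C \<subseteq> pverts G"
      using sub by (auto simp: pverts_corona)
    have pendant_nbr: "q = Inl u" if "(Inr (u, x), q) \<in> parcs (corona G H)" for u q
      using that no_arcs by (cases q) (auto simp: parcs_corona_simps)
    have leaf: "Inr (u, x) \<in> S" if "u \<in> pverts G" for u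
    proof (rule ccontr)
      assume "Inr (u, x) \<notin> S"
      then have "Inr (u, x) \<in> pverts (corona G H) - S"
        using that x by (auto simp: pverts_corona)
      from served[OF this] have "Inl u \<in> R" "Inl u \<in> B"
        using pendant_nbr by blast+
      with RB(2) show False by blast
    qed
    have "dominating_set G ?C"
      unfolding dominating_set_def
    proof (intro conjI ballI C)
      fix u assume u: "u \<in> pverts G - ?C"
      \<comment> \<open>\<open>Q\<close> is the colour that the pendant vertex at \<open>u\<close> does not have.\<close>
      obtain Q where Q: "Q = R \<or> Q = B" "Inr (u, x) \<notin> Q"
        using RB(2) by blast
      have "Inl u \<in> pverts (corona G H) - S"
        using u by (auto simp: pverts_corona)
      then obtain q where q: "q \<in> Q" "(Inl u, q) \<in> parcs (corona G H)"
        using served[of "Inl u"] Q(1) by blast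
      have "\<exists>v. q = Inl v"
        using q Q(2) x by (cases q) (auto simp: parcs_corona_simps)
      then show "\<exists>v\<in>?C. (u, v) \<in> parcs G"
        using q Q(1) RB(1) by (auto simp: parcs_corona_simps)
    qed
    then have "domination_number G \<le> card ?C"
      by (rule domination_number_le)
    moreover have "S = ?C <+> pverts G \<times> {x}"
      using sub leaf x by (auto simp: pverts_corona)
    then have "card S = card ?C + card (pverts G)"
      using finite_subset[OF C G.pair_finite_verts] G.pair_finite_verts
        card_Plus[of ?C "pverts G \<times> {x}"] by (simp add: card_cartesian_product)
    ultimately show ?thesis
      using S(2) by simp
  qed
qed

theorem theorem3p5:
  fixes G :: "'a pair_pre_digraph" and H :: "'b pair_pre_digraph" and m :: nat
  assumes "pair_graph G" and "pair_graph H"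
    and "pverts G \<noteq> {}" and "pverts H \<noteq> {}"
    and "card (pverts G) = m"
  shows "ds_domination_number (corona G H) =
    (if \<not> digraph_iso (with_proj H) (with_proj K1)
     then m * min (ds_domination_number H) (1 + domination_number H)
     else m + domination_number G)"
proof (cases "card (pverts H) = 1")
  case True
  then obtain x where "pverts H = {x}"
    by (metis card_1_singletonE)
  then show ?thesis
    using ds_domination_number_corona_singleton assms digraph_iso_K1_iff[OF assms(2)] True by metis
next
  case False
  interpret H: pair_graph H by fact
  have "card (pverts H) \<noteq> 0"
    using assms(4) H.pair_finite_verts by simp
  with False have "2 \<le> card (pverts H)"
    by linarith
  then have "ds_domination_number (corona G H)
    = m * min (ds_domination_number H) (1 + domination_number H)"
    using ds_domination_number_corona_ge[OF assms(1,2)]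
      ds_domination_number_corona_le_ds[of H G]
      ds_domination_number_corona_le_dom[OF assms(1,2)] assms(5)
    by (auto simp: min_def split: if_splits intro: antisym)
  then show ?thesis
    using False digraph_iso_K1_iff[OF assms(2)] by simp
qed

end
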